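(* Consider the fully composite problem $\varphi^*=\min_{x\in\operatorname{dom}\varphi}\{\varphi(x)=F(x,f(x))\}$ with subhomogeneous outer function (see context), where each component of $f:\mathbb{E}\to\mathbb{R}^m$ is convex and continuously differentiable on $\mathbb{E}$ with Lipschitz continuous gradient, and $F(L_1(f))<+\infty$. Let $x_0\in\operatorname{dom}\varphi$, $\alpha\ge1$, $M=\alpha F(L_1(f))$, $v_0=x_0$, $A_0=0$, and let the sequences be generated by the Fully Composite Fast Gradient Method: for $k\ge0$, 1. $a_{k+1}>0$ is the positive solution of $A_k+a_{k+1}=a_{k+1}^2$, and $A_{k+1}=A_k+a_{k+1}$; 2. $y_k=\dfrac{a_{k+1}v_k+A_kx_k}{A_{k+1}}$; 3. $x_{k+1}\in\operatorname*{argmin}_{y\in\operatorname{dom}\varphi}\Big\{F\big(y,\ f(y_k)+\langle\nabla f(y_k),y-y_k\rangle\big)+\frac M2\|y-y_k\|^2\Big\}$ (a minimizer is assumed to exist); 4. $v_{k+1}=x_{k+1}+\dfrac{A_k}{a_{k+1}}(x_{k+1}-x_k)$. Then for all $k\ge1$ and all $x\in\operatorname{dom}\varphi$, $$A_k\varphi(x_k)+\tfrac M2\|x-v_k\|^2\ \le\ A_k\varphi(x)+\tfrac M2\|x-x_0\|^2 .$$ Consequently, for all $k\ge1$, $$\varphi(x_k)-\varphi^*\ \le\ \frac{M\|x^*-x_0\|^2}{2A_k}\ \le\ \frac{2M\|x^*-x_0\|^2}{k^2}.$$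
   Context: $\mathbb{E}$ is a finite-dimensional real vector space with norm $\|x\|=\langle Bx,x\rangle^{1/2}$, where $B:\mathbb{E}\to\mathbb{E}^*$ is self-adjoint positive definite, and dual norm $\|g\|_*=\langle g,B^{-1}g\rangle^{1/2}$. Fully composite problem: $F:\mathbb{E}\times\mathbb{R}^m\to\mathbb{R}\cup\{+\infty\}$ is closed and convex, and for every $x$ the function $F(x,\cdot)$ is monotone: $u\le v$ componentwise implies $F(x,u)\le F(x,v)$. $f=(f_1,\dots,f_m)^T:\mathbb{E}\to\mathbb{R}^m$ with all $f_i$ convex. $\varphi(x)=F(x,f(x))$, $\operatorname{dom}\varphi=\{x\in\mathbb{E}:F(x,f(x))<+\infty\}$, and $x^*$ is a minimizer, $\varphi(x^* )=\varphi^*$, assumed to exist. Subhomogeneity: for every $x\in\operatorname{dom}\varphi$, $F(x,\cdot)$ is finite on all of $\mathbb{R}^m$ and $F(x,u+tv)\le F(x,u)+tF(x,v)$ for all $u,v\in\mathbb{R}^m$, $t\ge0$. $\langle\nabla f(x),h\rangle$ denotes the vector $(\langle\nabla f_i(x),h\rangle)_{i=1}^m$. $L_1(f_i)<+\infty$ is a constant with $\|\nabla f_i(x)-\nabla f_i(y)\|_*\le L_1(f_i)\|x-y\|$ for all $x,y$; $L_1(f)=(L_1(f_1),\dots,L_1(f_m))^T$. Notation: $F(L_1(f))=\sup_{x\in\operatorname{dom}\varphi}F(x,L_1(f))$. *)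

theory Defs
  imports "HOL-Analysis.Analysis"
begin

text \<open>
  The finite-dimensional space is a type of class \<open>euclidean_space\<close>, used only through its
  vector space structure and topology: the ambient inner product plays no role. The geometry
  comes from an operator \<open>B\<close> into the dual space, which is rendered as \<open>'a \<Rightarrow>\<^sub>L real\<close>.
\<close>

definition self_adjoint_pos_def :: "('a::euclidean_space \<Rightarrow> ('a \<Rightarrow>\<^sub>L real)) \<Rightarrow> bool" where
  "self_adjoint_pos_def B \<longleftrightarrow>
     linear B \<and>
     (\<forall>x y. blinfun_apply (B x) y = blinfun_apply (B y) x) \<and>
     (\<forall>x. x \<noteq> 0 \<longrightarrow> blinfun_apply (B x) x > 0)"

definition normB :: "('a::euclidean_space \<Rightarrow> ('a \<Rightarrow>\<^sub>L real)) \<Rightarrow> 'a \<Rightarrow> real" where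
  "normB B x = sqrt (blinfun_apply (B x) x)"

text \<open>
  A positive definite \<open>B\<close> is injective, hence bijective because both spaces have the same finite
  dimension, so \<open>inv B\<close> is a genuine inverse.
\<close>

definition dual_normB :: "('a::euclidean_space \<Rightarrow> ('a \<Rightarrow>\<^sub>L real)) \<Rightarrow> ('a \<Rightarrow>\<^sub>L real) \<Rightarrow> real" where
  "dual_normB B g = sqrt (blinfun_apply g (inv B g))"

definition ereal_epigraph :: "('b \<Rightarrow> ereal) \<Rightarrow> ('b \<times> real) set" where
  "ereal_epigraph h = {(z, t). h z \<le> ereal t}"

definition closed_convex_fun :: "('b::real_normed_vector \<Rightarrow> ereal) \<Rightarrow> bool" where
  "closed_convex_fun h \<longleftrightarrow> closed (ereal_epigraph h) \<and> convex (ereal_epigraph h)"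

definition composite :: "('a \<Rightarrow> real^'m \<Rightarrow> ereal) \<Rightarrow> ('a \<Rightarrow> real^'m) \<Rightarrow> 'a \<Rightarrow> ereal" where
  "composite F f x = F x (f x)"

definition composite_dom :: "('a \<Rightarrow> real^'m \<Rightarrow> ereal) \<Rightarrow> ('a \<Rightarrow> real^'m) \<Rightarrow> 'a set" where
  "composite_dom F f = {x. composite F f x < \<infinity>}"

definition composite_opt :: "('a \<Rightarrow> real^'m \<Rightarrow> ereal) \<Rightarrow> ('a \<Rightarrow> real^'m) \<Rightarrow> ereal" where
  "composite_opt F f = (INF x\<in>composite_dom F f. composite F f x)"

definition subhomogeneous_on :: "'a set \<Rightarrow> ('a \<Rightarrow> real^'m \<Rightarrow> ereal) \<Rightarrow> bool" where
  "subhomogeneous_on D F \<longleftrightarrow>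
     (\<forall>x\<in>D. (\<forall>u. \<bar>F x u\<bar> \<noteq> \<infinity>) \<and>
        (\<forall>u v. \<forall>t::real. t \<ge> 0 \<longrightarrow> F x (u + t *\<^sub>R v) \<le> F x u + ereal t * F x v))"

definition outer_sup :: "'a set \<Rightarrow> ('a \<Rightarrow> real^'m \<Rightarrow> ereal) \<Rightarrow> real^'m \<Rightarrow> ereal" where
  "outer_sup D F u = (SUP x\<in>D. F x u)"

text \<open>\<open>f y + \<langle>\<nabla>f y, z - y\<rangle>\<close>, where \<open>df i y\<close> is the gradient (a covector) of the \<open>i\<close>-th component.\<close>

definition linearization ::
  "('a \<Rightarrow> real^'m) \<Rightarrow> ('m \<Rightarrow> 'a \<Rightarrow> ('a::euclidean_space \<Rightarrow>\<^sub>L real)) \<Rightarrow> 'a \<Rightarrow> 'a \<Rightarrow> real^'m" where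
  "linearization f df y z = f y + (\<chi> i. blinfun_apply (df i y) (z - y))"

end

theory Submission
  imports Defs
begin

text \<open>
  Write \<open>\<phi> z = F z (f z)\<close> and \<open>D = dom \<phi>\<close>. The linearized model
  \<open>z \<mapsto> F z (f y + \<langle>\<nabla>f y, z - y\<rangle>)\<close> is sandwiched by \<open>\<phi>\<close>: it lies below \<open>\<phi>\<close> because each
  \<open>f\<^sub>i\<close> is convex and \<open>F z\<close> is monotone, and \<open>\<phi>\<close> exceeds it by at most \<open>M/2 \<parallel>z - y\<parallel>\<^sup>2\<close> because
  \<open>f z\<close> exceeds its linearization by at most \<open>\<parallel>z - y\<parallel>\<^sup>2/2\<close> times the vector of Lipschitz
  constants, and subhomogeneity takes this multiple out of \<open>F z\<close> at the price \<open>F z L \<le> M\<close>.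
  The model is convex, since \<open>F\<close> is jointly convex, so the regularized model
  grows by \<open>M/2 \<parallel>z - x\<^sub>+\<parallel>\<^sup>2\<close> away from its minimizer \<open>x\<^sub>+\<close>. Together this gives the only
  inequality about a single iteration that is needed (\<open>composite_prox_step\<close>):
  \<open>\<phi> x\<^sub>+ + M/2 \<parallel>z - x\<^sub>+\<parallel>\<^sup>2 \<le> \<phi> z + M/2 \<parallel>z - y\<parallel>\<^sup>2\<close> for all \<open>z \<in> D\<close>.

  Acceleration comes from evaluating it not at a competitor \<open>z\<close> itself but at the average of
  \<open>z\<close> and \<open>x\<^sub>k\<close> with weights \<open>a\<^sub>k\<^sub>+\<^sub>1\<close> and \<open>A\<^sub>k\<close>. The points \<open>y\<^sub>k\<close> and \<open>v\<^sub>k\<^sub>+\<^sub>1\<close> are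
  chosen so that both distances become the same multiple \<open>a\<^sub>k\<^sub>+\<^sub>1 / A\<^sub>k\<^sub>+\<^sub>1\<close> of the distances from
  \<open>z\<close> to \<open>v\<^sub>k\<close> and to \<open>v\<^sub>k\<^sub>+\<^sub>1\<close>, and \<open>A\<^sub>k\<^sub>+\<^sub>1 = a\<^sub>k\<^sub>+\<^sub>1\<^sup>2\<close> makes this multiple cancel
  (\<open>accelerated_potential_step\<close>). Hence \<open>A\<^sub>k (\<phi> x\<^sub>k - \<phi> z) + M/2 \<parallel>z - v\<^sub>k\<parallel>\<^sup>2\<close> does not increase
  with \<open>k\<close>. The rate follows from \<open>A\<^sub>k \<ge> k\<^sup>2/4\<close>, since \<open>sqrt A\<^sub>k\<close> grows by
  at least one half per step (\<open>accelerated_weights_growth\<close>).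
\<close>

section \<open>The norm of a positive definite operator\<close>

lemma self_adjoint_pos_def_linear: "self_adjoint_pos_def B \<Longrightarrow> linear B"
  and self_adjoint_pos_def_sym:
    "self_adjoint_pos_def B \<Longrightarrow> blinfun_apply (B x) y = blinfun_apply (B y) x"
  and self_adjoint_pos_def_pos:
    "self_adjoint_pos_def B \<Longrightarrow> x \<noteq> 0 \<Longrightarrow> blinfun_apply (B x) x > 0"
  by (auto simp: self_adjoint_pos_def_def)

lemma self_adjoint_pos_def_nonneg:
  assumes "self_adjoint_pos_def B"
  shows "blinfun_apply (B x) x \<ge> 0"
  using self_adjoint_pos_def_pos[OF assms, of x] by (cases "x = 0") auto

lemma normB_power2:
  assumes "self_adjoint_pos_def B"
  shows "(normB B x)\<^sup>2 = blinfun_apply (B x) x"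
  unfolding normB_def using self_adjoint_pos_def_nonneg[OF assms] by simp

lemma normB_nonneg: "self_adjoint_pos_def B \<Longrightarrow> normB B x \<ge> 0"
  unfolding normB_def using self_adjoint_pos_def_nonneg by simp

lemma normB_pos: "self_adjoint_pos_def B \<Longrightarrow> x \<noteq> 0 \<Longrightarrow> normB B x > 0"
  unfolding normB_def using self_adjoint_pos_def_pos by simp

lemma normB_scaleR_power2:
  assumes "self_adjoint_pos_def B"
  shows "(normB B (c *\<^sub>R x))\<^sup>2 = c\<^sup>2 * (normB B x)\<^sup>2"
  unfolding normB_power2[OF assms]
  by (simp add: linear_scale[OF self_adjoint_pos_def_linear[OF assms]]
      blinfun.scaleR_left blinfun.scaleR_right power2_eq_square)

text \<open>
  The parallelogram-type identity behind the strong convexity of \<open>\<parallel>z - y\<parallel>\<^sup>2\<close>: the deficit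
  in Jensen's inequality is a multiple of the squared distance of the two points.
\<close>
lemma normB_power2_convex_combination:
  assumes "self_adjoint_pos_def B"
  shows "(normB B ((1 - t) *\<^sub>R p + t *\<^sub>R q - y))\<^sup>2 =
    (1 - t) * (normB B (p - y))\<^sup>2 + t * (normB B (q - y))\<^sup>2 - t * (1 - t) * (normB B (q - p))\<^sup>2"
proof -
  note lin = self_adjoint_pos_def_linear[OF assms]
  have "blinfun_apply (B p) q = blinfun_apply (B q) p" "blinfun_apply (B p) y = blinfun_apply (B y) p"
    "blinfun_apply (B y) q = blinfun_apply (B q) y"
    by (rule self_adjoint_pos_def_sym[OF assms])+
  then show ?thesis
    by (simp add: normB_power2[OF assms] linear_add[OF lin] linear_diff[OF lin]
        linear_scale[OF lin] blinfun.bilinear_simps) (simp add: algebra_simps power2_eq_square)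
qed

lemma normB_Cauchy_Schwarz:
  assumes "self_adjoint_pos_def B"
  shows "blinfun_apply (B x) y \<le> normB B x * normB B y"
proof (cases "y = 0")
  case True
  then show ?thesis by (simp add: normB_def)
next
  case False
  note lin = self_adjoint_pos_def_linear[OF assms]
  define q where "q = blinfun_apply (B y) y"
  define p where "p = blinfun_apply (B x) y"
  have q: "q > 0"
    using self_adjoint_pos_def_pos[OF assms False] by (simp add: q_def)
  have p: "blinfun_apply (B y) x = p"
    unfolding p_def by (rule self_adjoint_pos_def_sym[OF assms])
  have "0 \<le> blinfun_apply (B (x - (p / q) *\<^sub>R y)) (x - (p / q) *\<^sub>R y)"
    by (rule self_adjoint_pos_def_nonneg[OF assms])
  also have "\<dots> = blinfun_apply (B x) x - p\<^sup>2 / q"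
    using q by (simp add: linear_diff[OF lin] linear_scale[OF lin] blinfun.bilinear_simps
        p p_def[symmetric] q_def[symmetric]) (simp add: field_simps power2_eq_square)
  finally have "p\<^sup>2 \<le> blinfun_apply (B x) x * q"
    using q by (simp add: field_simps)
  also have "\<dots> = (normB B x * normB B y)\<^sup>2"
    by (simp add: power_mult_distrib normB_power2[OF assms] q_def)
  finally show ?thesis
    unfolding p_def
    by (rule power2_le_imp_le) (simp add: normB_nonneg[OF assms])
qed

text \<open>
  Injectivity gives surjectivity by a dimension count, carried out on the coordinate vectors of
  the functionals so as to stay within one Euclidean space.
\<close>
lemma self_adjoint_pos_def_surj:
  fixes B :: "'a::euclidean_space \<Rightarrow> ('a \<Rightarrow>\<^sub>L real)"
  assumes "self_adjoint_pos_def B"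
  shows "surj B"
proof -
  note lin = self_adjoint_pos_def_linear[OF assms]
  define T where "T g = (\<Sum>b\<in>Basis. blinfun_apply g b *\<^sub>R b)" for g :: "'a \<Rightarrow>\<^sub>L real"
  have T_inner: "T g \<bullet> b = blinfun_apply g b" if "b \<in> Basis" for g b
    using that by (simp add: T_def)
  have T_inj: "g = h" if "T g = T h" for g h
    by (rule blinfun_euclidean_eqI) (metis T_inner that)
  have T_lin: "linear T"
    by (rule linearI) (simp_all add: T_def blinfun.bilinear_simps scaleR_add_left sum.distrib
        scaleR_sum_right)
  have TB_lin: "linear (T \<circ> B)"
    by (rule linear_compose[OF lin T_lin])
  have "inj (T \<circ> B)"
    unfolding linear_injective_0[OF TB_lin]
  proof (intro allI impI)
    fix z assume "(T \<circ> B) z = 0"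
    then have "B z = 0"
      using T_inj[of "B z" 0] by (simp add: linear_0[OF T_lin])
    then show "z = 0"
      using self_adjoint_pos_def_pos[OF assms, of z] by auto
  qed
  then have "surj (T \<circ> B)"
    by (rule eucl.linear_inj_imp_surj[OF TB_lin])
  then show ?thesis
    unfolding surj_def by (metis T_inj comp_apply)
qed

lemma dual_normB_bound:
  assumes "self_adjoint_pos_def B"
  shows "blinfun_apply g h \<le> dual_normB B g * normB B h"
proof -
  have g: "B (inv B g) = g"
    by (rule surj_f_inv_f[OF self_adjoint_pos_def_surj[OF assms]])
  show ?thesis
    using normB_Cauchy_Schwarz[OF assms, of "inv B g" h] by (simp add: g dual_normB_def normB_def)
qed

lemma dual_normB_nonneg:
  assumes "self_adjoint_pos_def B"
  shows "dual_normB B g \<ge> 0"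
  using self_adjoint_pos_def_nonneg[OF assms, of "inv B g"]
  by (simp add: dual_normB_def surj_f_inv_f[OF self_adjoint_pos_def_surj[OF assms]])

section \<open>First-order bounds for smooth convex functions\<close>

lemma has_derivative_along_line:
  fixes g :: "'a::real_normed_vector \<Rightarrow> real" and dg :: "'a \<Rightarrow> ('a \<Rightarrow>\<^sub>L real)"
  assumes "\<And>z. (g has_derivative blinfun_apply (dg z)) (at z)"
  shows "((\<lambda>t. g (y + t *\<^sub>R h)) has_real_derivative blinfun_apply (dg (y + t *\<^sub>R h)) h) (at t)"
proof -
  have line: "((\<lambda>t. y + t *\<^sub>R h) has_derivative (\<lambda>s. s *\<^sub>R h)) (at t)"
    by (auto intro!: derivative_eq_intros)
  have "((\<lambda>t. g (y + t *\<^sub>R h)) has_derivative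
      (\<lambda>s. blinfun_apply (dg (y + t *\<^sub>R h)) (s *\<^sub>R h))) (at t)"
    using has_derivative_compose[OF line, of g] assms by blast
  then show ?thesis
    by (simp add: has_field_derivative_def blinfun.scaleR_right mult.commute[of _ "blinfun_apply _ _"])
qed

lemma convex_above_linearization:
  fixes g :: "'a::real_normed_vector \<Rightarrow> real" and dg :: "'a \<Rightarrow> ('a \<Rightarrow>\<^sub>L real)"
  assumes conv: "convex_on UNIV g"
    and der: "\<And>z. (g has_derivative blinfun_apply (dg z)) (at z)"
  shows "g y + blinfun_apply (dg y) (z - y) \<le> g z"
proof -
  define \<psi> where "\<psi> t = g (y + t *\<^sub>R (z - y))" for t
  have "convex_on UNIV \<psi>"
  proof (rule convex_onI)
    fix t :: real and p q :: real
    assume t: "0 < t" "t < 1"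
    have "y + ((1 - t) *\<^sub>R p + t *\<^sub>R q) *\<^sub>R (z - y) =
        (1 - t) *\<^sub>R (y + p *\<^sub>R (z - y)) + t *\<^sub>R (y + q *\<^sub>R (z - y))"
      by (simp add: algebra_simps)
    then show "\<psi> ((1 - t) *\<^sub>R p + t *\<^sub>R q) \<le> (1 - t) * \<psi> p + t * \<psi> q"
      unfolding \<psi>_def using convex_onD[OF conv] t by simp
  qed auto
  moreover have "(\<psi> has_real_derivative blinfun_apply (dg y) (z - y)) (at 0)"
    unfolding \<psi>_def using has_derivative_along_line[OF der, of y "z - y" 0] by simp
  ultimately have "\<psi> 1 - \<psi> 0 \<ge> blinfun_apply (dg y) (z - y) * (1 - 0)"
    by (intro convex_on_imp_above_tangent[of UNIV]) auto
  then show ?thesis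
    by (simp add: \<psi>_def)
qed

text \<open>
  The descent lemma. Along the segment from \<open>y\<close> to \<open>z\<close>, the Lipschitz bound says precisely that
  the difference of the two sides has a nonpositive derivative.
\<close>
lemma Lipschitz_gradient_upper_bound:
  fixes g :: "'a::euclidean_space \<Rightarrow> real" and dg :: "'a \<Rightarrow> ('a \<Rightarrow>\<^sub>L real)"
  assumes B: "self_adjoint_pos_def B"
    and der: "\<And>z. (g has_derivative blinfun_apply (dg z)) (at z)"
    and lip: "\<And>z w. dual_normB B (dg z - dg w) \<le> l * normB B (z - w)"
  shows "g z \<le> g y + blinfun_apply (dg y) (z - y) + l / 2 * (normB B (z - y))\<^sup>2"
proof -
  define h where "h = z - y"
  define \<psi> where "\<psi> t = g (y + t *\<^sub>R h) - t * blinfun_apply (dg y) h - l / 2 * t\<^sup>2 * (normB B h)\<^sup>2" for t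
  have "\<psi> 1 \<le> \<psi> 0"
  proof (rule DERIV_nonpos_imp_nonincreasing[of 0 1])
    fix t :: real
    assume t: "0 \<le> t" "t \<le> 1"
    have "(\<psi> has_real_derivative
        blinfun_apply (dg (y + t *\<^sub>R h)) h - blinfun_apply (dg y) h - l * t * (normB B h)\<^sup>2) (at t)"
      unfolding \<psi>_def by (auto intro!: derivative_eq_intros has_derivative_along_line[OF der])
    moreover have "blinfun_apply (dg (y + t *\<^sub>R h)) h - blinfun_apply (dg y) h \<le> l * t * (normB B h)\<^sup>2"
    proof -
      have "normB B (t *\<^sub>R h) = t * normB B h"
        using normB_scaleR_power2[OF B, of t h] normB_nonneg[OF B] t
        by (simp add: power_mult_distrib[symmetric])
      then have "dual_normB B (dg (y + t *\<^sub>R h) - dg y) \<le> l * (t * normB B h)"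
        using lip[of "y + t *\<^sub>R h" y] by simp
      then have "dual_normB B (dg (y + t *\<^sub>R h) - dg y) * normB B h \<le> l * (t * normB B h) * normB B h"
        by (rule mult_right_mono) (rule normB_nonneg[OF B])
      then show ?thesis
        using dual_normB_bound[OF B, of "dg (y + t *\<^sub>R h) - dg y" h]
        by (simp add: blinfun.diff_left power2_eq_square mult.assoc)
    qed
    ultimately show "\<exists>d. (\<psi> has_real_derivative d) (at t) \<and> d \<le> 0"
      by (intro exI conjI) auto
  qed simp
  then show ?thesis
    by (simp add: \<psi>_def h_def)
qed

section \<open>Convexity of the composition and of its model\<close>

text \<open>
  Joint convexity of \<open>F\<close> bounds the value at the averaged inner values, and monotonicity
  replaces these by the smaller inner value at the averaged point. This covers both the objective
  (\<open>l = f\<close>) and the model (\<open>l\<close> the affine linearization of \<open>f\<close>). The bounds \<open>p\<close> and \<open>q\<close> are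
  real because the epigraph contains only real heights.
\<close>
lemma monotone_composition_Jensen:
  fixes F :: "'a::real_normed_vector \<Rightarrow> real^'m \<Rightarrow> ereal"
  assumes F: "closed_convex_fun (\<lambda>(z, u). F z u)"
    and mono: "\<And>z. mono (F z)"
    and l: "\<And>i. convex_on UNIV (\<lambda>z. l z $ i)"
    and bounds: "F z (l z) \<le> ereal p" "F w (l w) \<le> ereal q"
    and t: "0 \<le> t" "t \<le> 1"
  shows "F ((1 - t) *\<^sub>R z + t *\<^sub>R w) (l ((1 - t) *\<^sub>R z + t *\<^sub>R w)) \<le> ereal ((1 - t) * p + t * q)"
proof -
  have "l ((1 - t) *\<^sub>R z + t *\<^sub>R w) \<le> (1 - t) *\<^sub>R l z + t *\<^sub>R l w"
    using convex_onD[OF l] t by (simp add: less_eq_vec_def)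
  then have "F ((1 - t) *\<^sub>R z + t *\<^sub>R w) (l ((1 - t) *\<^sub>R z + t *\<^sub>R w)) \<le>
      F ((1 - t) *\<^sub>R z + t *\<^sub>R w) ((1 - t) *\<^sub>R l z + t *\<^sub>R l w)"
    using mono by (auto dest: monoD)
  also have "\<dots> \<le> ereal ((1 - t) * p + t * q)"
  proof -
    have "convex (ereal_epigraph (\<lambda>(z, u). F z u))"
      using F by (simp add: closed_convex_fun_def)
    moreover have "((z, l z), p) \<in> ereal_epigraph (\<lambda>(z, u). F z u)"
      "((w, l w), q) \<in> ereal_epigraph (\<lambda>(z, u). F z u)"
      using bounds by (simp_all add: ereal_epigraph_def)
    ultimately have "(1 - t) *\<^sub>R ((z, l z), p) + t *\<^sub>R ((w, l w), q) \<in>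
        ereal_epigraph (\<lambda>(z, u). F z u)"
      using t by (intro convexD) auto
    then show ?thesis
      by (simp add: ereal_epigraph_def)
  qed
  finally show ?thesis .
qed

lemma subhomogeneous_on_real:
  assumes "subhomogeneous_on D F" "z \<in> D"
  shows "F z u = ereal (real_of_ereal (F z u))"
  using assms by (simp add: subhomogeneous_on_def ereal_real')

lemma convex_composite_dom:
  fixes F :: "'a::real_normed_vector \<Rightarrow> real^'m \<Rightarrow> ereal"
  assumes F: "closed_convex_fun (\<lambda>(z, u). F z u)"
    and mono: "\<And>z. mono (F z)"
    and sub: "subhomogeneous_on (composite_dom F f) F"
    and f: "\<And>i. convex_on UNIV (\<lambda>z. f z $ i)"
  shows "convex (composite_dom F f)"
  unfolding convex_alt
proof (intro ballI allI impI)
  fix z w and t :: real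
  assume zw: "z \<in> composite_dom F f" "w \<in> composite_dom F f" and t: "0 \<le> t \<and> t \<le> 1"
  have "F ((1 - t) *\<^sub>R z + t *\<^sub>R w) (f ((1 - t) *\<^sub>R z + t *\<^sub>R w)) \<le>
      ereal ((1 - t) * real_of_ereal (F z (f z)) + t * real_of_ereal (F w (f w)))"
    using subhomogeneous_on_real[OF sub] zw t
    by (intro monotone_composition_Jensen[OF F mono f]) (metis order_refl)+
  also have "\<dots> < \<infinity>"
    by simp
  finally show "(1 - t) *\<^sub>R z + t *\<^sub>R w \<in> composite_dom F f"
    by (simp add: composite_dom_def composite_def)
qed

lemma convex_on_monotone_composition:
  fixes F :: "'a::real_normed_vector \<Rightarrow> real^'m \<Rightarrow> ereal"
  assumes F: "closed_convex_fun (\<lambda>(z, u). F z u)"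
    and mono: "\<And>z. mono (F z)"
    and sub: "subhomogeneous_on D F"
    and D: "convex D"
    and l: "\<And>i. convex_on UNIV (\<lambda>z. l z $ i)"
  shows "convex_on D (\<lambda>z. real_of_ereal (F z (l z)))"
proof (rule convex_onI[OF _ D])
  fix t z w
  assume t: "0 < (t::real)" "t < 1" and zw: "z \<in> D" "w \<in> D"
  have "(1 - t) *\<^sub>R z + t *\<^sub>R w \<in> D"
    using convexD_alt[OF D zw] t by simp
  moreover have "F ((1 - t) *\<^sub>R z + t *\<^sub>R w) (l ((1 - t) *\<^sub>R z + t *\<^sub>R w)) \<le>
      ereal ((1 - t) * real_of_ereal (F z (l z)) + t * real_of_ereal (F w (l w)))"
    using subhomogeneous_on_real[OF sub] zw t
    by (intro monotone_composition_Jensen[OF F mono l]) (metis order_refl less_imp_le)+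
  ultimately show "real_of_ereal (F ((1 - t) *\<^sub>R z + t *\<^sub>R w) (l ((1 - t) *\<^sub>R z + t *\<^sub>R w))) \<le>
      (1 - t) * real_of_ereal (F z (l z)) + t * real_of_ereal (F w (l w))"
    using subhomogeneous_on_real[OF sub] by (metis ereal_less_eq(3))
qed

lemma linearization_component_convex: "convex_on UNIV (\<lambda>z. linearization f df y z $ i)"
  by (rule convex_onI) (simp_all add: linearization_def blinfun.bilinear_simps algebra_simps)

section \<open>One regularized step\<close>

text \<open>
  Quadratic growth at the minimizer of a convex function plus \<open>M/2 \<parallel>z - y\<parallel>\<^sup>2\<close>. Minimality is
  compared with points on the segment towards \<open>z\<close>; dividing by the step \<open>t\<close> leaves the claim with
  the factor \<open>1 - t\<close> on the growth term, and \<open>t\<close> is arbitrarily small.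
\<close>
lemma prox_quadratic_growth:
  assumes B: "self_adjoint_pos_def B"
    and h: "convex_on D h"
    and p: "p \<in> D"
    and min: "\<And>z. z \<in> D \<Longrightarrow> h p + M / 2 * (normB B (p - y))\<^sup>2 \<le> h z + M / 2 * (normB B (z - y))\<^sup>2"
    and z: "z \<in> D"
  shows "h p + M / 2 * (normB B (p - y))\<^sup>2 + M / 2 * (normB B (z - p))\<^sup>2 \<le>
    h z + M / 2 * (normB B (z - y))\<^sup>2"
proof -
  define c where "c = M / 2 * (normB B (z - p))\<^sup>2"
  define d where "d = h z + M / 2 * (normB B (z - y))\<^sup>2 - (h p + M / 2 * (normB B (p - y))\<^sup>2)"
  have "c \<le> d"
  proof (rule field_le_mult_one_interval)
    fix s :: real
    assume s: "0 < s" "s < 1"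
    define t where "t = 1 - s"
    have t: "0 < t" "t < 1"
      using s by (auto simp: t_def)
    let ?w = "(1 - t) *\<^sub>R p + t *\<^sub>R z"
    have "?w \<in> D"
      using convexD_alt[OF convex_on_imp_convex[OF h] p z] t by simp
    then have "h p + M / 2 * (normB B (p - y))\<^sup>2 \<le> h ?w + M / 2 * (normB B (?w - y))\<^sup>2"
      by (rule min)
    also have "h ?w \<le> (1 - t) * h p + t * h z"
      using convex_onD[OF h] p z t by simp
    finally have "0 \<le> t * (d - (1 - t) * c)"
      unfolding normB_power2_convex_combination[OF B] c_def d_def by (simp add: algebra_simps diff_divide_distrib)
    then show "s * c \<le> d"
      using t by (simp add: zero_le_mult_iff t_def)
  qed
  then show ?thesis
    by (simp add: c_def d_def)
qed

text \<open>
  The lower bound \<open>linearization \<le> f\<close> is used at the competitor \<open>z\<close> and the upper bound at the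
  minimizer \<open>p\<close>; there the term \<open>M/2 \<parallel>p - y\<parallel>\<^sup>2\<close> pays for the passage from the model to the
  objective. The first argument of \<open>F\<close> is \<open>z\<close> or \<open>p\<close> throughout, so \<open>y\<close> may lie outside \<open>D\<close>.
\<close>
lemma composite_prox_step:
  fixes B :: "'a::euclidean_space \<Rightarrow> ('a \<Rightarrow>\<^sub>L real)"
    and F :: "'a \<Rightarrow> real^'m \<Rightarrow> ereal"
  defines "\<phi> \<equiv> \<lambda>f z. real_of_ereal (composite F f z)"
  assumes B: "self_adjoint_pos_def B"
    and F: "closed_convex_fun (\<lambda>(z, u). F z u)"
    and mono: "\<And>z. mono (F z)"
    and sub: "subhomogeneous_on D F"
    and D: "convex D"
    and f_convex: "\<And>i. convex_on UNIV (\<lambda>z. f z $ i)"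
    and f_deriv: "\<And>i z. ((\<lambda>w. f w $ i) has_derivative blinfun_apply (df i z)) (at z)"
    and df_Lipschitz: "\<And>i z w. dual_normB B (df i z - df i w) \<le> L $ i * normB B (z - w)"
    and M: "\<And>z. z \<in> D \<Longrightarrow> F z L \<le> ereal M"
    and p: "is_arg_min (\<lambda>z. F z (linearization f df y z) + ereal (M / 2 * (normB B (z - y))\<^sup>2))
      (\<lambda>z. z \<in> D) p"
    and z: "z \<in> D"
  shows "\<phi> f p + M / 2 * (normB B (z - p))\<^sup>2 \<le> \<phi> f z + M / 2 * (normB B (z - y))\<^sup>2"
proof -
  define h where "h z = real_of_ereal (F z (linearization f df y z))" for z
  define r where "r = (normB B (p - y))\<^sup>2 / 2"
  note real = subhomogeneous_on_real[OF sub]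
  have h: "F w (linearization f df y w) = ereal (h w)" if "w \<in> D" for w
    unfolding h_def using real[OF that] .
  have \<phi>: "F w (f w) = ereal (\<phi> f w)" if "w \<in> D" for w
    unfolding \<phi>_def composite_def using real[OF that] .
  have pD: "p \<in> D"
    using p by (simp add: is_arg_min_def)
  have min: "h p + M / 2 * (normB B (p - y))\<^sup>2 \<le> h w + M / 2 * (normB B (w - y))\<^sup>2" if "w \<in> D" for w
    using p that h[OF pD] h[OF that] by (auto simp: is_arg_min_linorder)
  have growth: "h p + M / 2 * (normB B (p - y))\<^sup>2 + M / 2 * (normB B (z - p))\<^sup>2 \<le>
      h z + M / 2 * (normB B (z - y))\<^sup>2"
  proof (rule prox_quadratic_growth[OF B _ pD min z])
    show "convex_on D h"
      unfolding h_def
      by (rule convex_on_monotone_composition[OF F mono sub D linearization_component_convex])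
  qed
  have lower: "h z \<le> \<phi> f z"
  proof -
    have "linearization f df y z \<le> f z"
      using convex_above_linearization[OF f_convex f_deriv]
      by (simp add: linearization_def less_eq_vec_def)
    then have "F z (linearization f df y z) \<le> F z (f z)"
      using mono by (auto dest: monoD)
    then show ?thesis
      by (simp add: h[OF z] \<phi>[OF z])
  qed
  have upper: "\<phi> f p \<le> h p + M / 2 * (normB B (p - y))\<^sup>2"
  proof -
    have r: "r \<ge> 0"
      by (simp add: r_def)
    have "f p \<le> linearization f df y p + r *\<^sub>R L"
      using Lipschitz_gradient_upper_bound[OF B f_deriv df_Lipschitz]
      by (simp add: linearization_def less_eq_vec_def r_def mult.commute)
    then have "F p (f p) \<le> F p (linearization f df y p + r *\<^sub>R L)"
      using mono by (auto dest: monoD)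
    also have "\<dots> \<le> F p (linearization f df y p) + ereal r * F p L"
      using sub pD r by (simp add: subhomogeneous_on_def)
    also have "\<dots> \<le> F p (linearization f df y p) + ereal r * ereal M"
      using M[OF pD] r by (intro add_left_mono ereal_mult_left_mono) auto
    finally show ?thesis
      by (simp add: h[OF pD] \<phi>[OF pD] r_def algebra_simps)
  qed
  from growth lower upper show ?thesis
    by linarith
qed

text \<open>
  At \<open>u = v = 0\<close>, \<open>t = 1\<close>, subhomogeneity reads \<open>F z 0 \<le> 2 F z 0\<close>. As \<open>F z 0\<close> is finite,
  \<open>F z\<close> is nonnegative at \<open>0\<close>, and by monotonicity above it.
\<close>
lemma subhomogeneous_on_nonneg:
  assumes sub: "subhomogeneous_on D F" and mono: "mono (F z)" and z: "z \<in> D" and u: "0 \<le> u"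
  shows "0 \<le> F z u"
proof -
  have "F z (0 + 1 *\<^sub>R 0) \<le> F z 0 + ereal 1 * F z 0"
    using sub z unfolding subhomogeneous_on_def by (metis zero_le_one)
  moreover have "F z 0 = ereal (real_of_ereal (F z 0))"
    by (rule subhomogeneous_on_real[OF sub z])
  ultimately have "0 \<le> F z 0"
    by (cases "F z 0") auto
  also have "\<dots> \<le> F z u"
    using mono u by (rule monoD)
  finally show ?thesis .
qed

section \<open>Acceleration\<close>

lemma accelerated_weight_ge_1:
  fixes A c :: real
  assumes "c > 0" "A \<ge> 0" "A + c = c\<^sup>2"
  shows "c \<ge> 1"
proof -
  have "1 * c \<le> c * c"
    using assms unfolding power2_eq_square by linarith
  then show ?thesis
    using assms(1) by (rule mult_right_le_imp_le)
qed

text \<open>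
  The one-step inequality is applied at \<open>w = (c z + A x) / c\<^sup>2\<close>. The definitions of \<open>y\<close> and \<open>v'\<close> give
  \<open>w - y = (z - v) / c\<close> and \<open>w - x' = (z - v') / c\<close>, so multiplying by \<open>c\<^sup>2\<close>
  restores the unscaled squared distances.
\<close>
lemma accelerated_potential_step:
  fixes B :: "'a::euclidean_space \<Rightarrow> ('a \<Rightarrow>\<^sub>L real)" and A c M :: real
  assumes B: "self_adjoint_pos_def B"
    and \<phi>: "convex_on D \<phi>"
    and step: "\<And>w. w \<in> D \<Longrightarrow>
      \<phi> x' + M / 2 * (normB B (w - x'))\<^sup>2 \<le> \<phi> w + M / 2 * (normB B (w - y))\<^sup>2"
    and c: "c > 0" and A: "A \<ge> 0" and Ac: "A + c = c\<^sup>2"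
    and y: "y = (1 / c\<^sup>2) *\<^sub>R (c *\<^sub>R v + A *\<^sub>R x)"
    and v': "v' = x' + (A / c) *\<^sub>R (x' - x)"
    and x: "x \<in> D" and z: "z \<in> D"
  shows "c\<^sup>2 * \<phi> x' + M / 2 * (normB B (z - v'))\<^sup>2 \<le> A * \<phi> x + c * \<phi> z + M / 2 * (normB B (z - v))\<^sup>2"
proof -
  define t where "t = 1 / c"
  have t: "0 < t" "t \<le> 1"
    using accelerated_weight_ge_1[OF c A Ac] by (auto simp: t_def)
  have one_minus_t: "A / c\<^sup>2 = 1 - t" "A = c\<^sup>2 * (1 - t)"
  proof -
    have A_eq: "A = c\<^sup>2 - c"
      using Ac by simp
    then show "A / c\<^sup>2 = 1 - t" "A = c\<^sup>2 * (1 - t)"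
      unfolding A_eq using c by (simp_all add: t_def power2_eq_square field_simps)
  qed
  define w where "w = (1 - t) *\<^sub>R x + t *\<^sub>R z"
  have wD: "w \<in> D"
    unfolding w_def using convexD_alt[OF convex_on_imp_convex[OF \<phi>] x z] t by simp
  have wy: "w - y = t *\<^sub>R (z - v)"
  proof -
    have "y = t *\<^sub>R v + (1 - t) *\<^sub>R x"
      using c one_minus_t(1) by (simp add: y scaleR_add_right t_def power2_eq_square)
    then show ?thesis
      by (simp add: w_def algebra_simps)
  qed
  have wx: "w - x' = t *\<^sub>R (z - v')"
  proof -
    have "t * (A / c) = 1 - t"
      using one_minus_t(1) by (simp add: t_def power2_eq_square)
    then have "t *\<^sub>R v' = t *\<^sub>R x' + (1 - t) *\<^sub>R (x' - x)"
      by (simp add: v' scaleR_add_right)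
    then show ?thesis
      by (simp add: w_def algebra_simps)
  qed
  have ct: "c\<^sup>2 * t\<^sup>2 = 1" "c\<^sup>2 * t = c"
    using c by (simp_all add: t_def power2_eq_square)
  have "\<phi> x' + M / 2 * (normB B (w - x'))\<^sup>2 \<le> \<phi> w + M / 2 * (normB B (w - y))\<^sup>2"
    by (rule step[OF wD])
  also have "\<phi> w \<le> (1 - t) * \<phi> x + t * \<phi> z"
    unfolding w_def using convex_onD[OF \<phi>] x z t by simp
  finally have "\<phi> x' + M / 2 * (t\<^sup>2 * (normB B (z - v'))\<^sup>2) \<le>
      (1 - t) * \<phi> x + t * \<phi> z + M / 2 * (t\<^sup>2 * (normB B (z - v))\<^sup>2)"
    unfolding wy wx normB_scaleR_power2[OF B] by simp
  then have "c\<^sup>2 * (\<phi> x' + M / 2 * (t\<^sup>2 * (normB B (z - v'))\<^sup>2)) \<le>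
      c\<^sup>2 * ((1 - t) * \<phi> x + t * \<phi> z + M / 2 * (t\<^sup>2 * (normB B (z - v))\<^sup>2))"
    by (rule mult_left_mono) simp
  then have "c\<^sup>2 * \<phi> x' + (c\<^sup>2 * t\<^sup>2) * (M / 2 * (normB B (z - v'))\<^sup>2) \<le>
      (c\<^sup>2 * (1 - t)) * \<phi> x + (c\<^sup>2 * t) * \<phi> z + (c\<^sup>2 * t\<^sup>2) * (M / 2 * (normB B (z - v))\<^sup>2)"
    by (simp add: distrib_left mult_ac)
  then show ?thesis
    by (simp only: ct one_minus_t(2)[symmetric] mult_1)
qed

text \<open>
  Since \<open>a\<^sub>k\<^sub>+\<^sub>1 = sqrt A\<^sub>k\<^sub>+\<^sub>1\<close> and completing the square gives \<open>(a\<^sub>k\<^sub>+\<^sub>1 - 1/2)\<^sup>2 = A\<^sub>k + 1/4\<close>,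
  \<open>sqrt A\<^sub>k\<close> increases by more than one half in each step.
\<close>
lemma accelerated_weights_growth:
  fixes a A :: "nat \<Rightarrow> real"
  assumes A0: "A 0 = 0"
    and a: "\<And>k. a (Suc k) > 0 \<and> A k + a (Suc k) = (a (Suc k))\<^sup>2"
    and A: "\<And>k. A (Suc k) = A k + a (Suc k)"
  shows "(real k)\<^sup>2 / 4 \<le> A k"
proof (induction k)
  case 0
  then show ?case by (simp add: A0)
next
  case (Suc k)
  define c where "c = a (Suc k)"
  have c: "c > 0" "A k + c = c\<^sup>2"
    using a[of k] by (simp_all add: c_def)
  have "A k \<ge> 0"
    by (rule order_trans[OF _ Suc.IH]) simp
  then have "c \<ge> 1"
    using accelerated_weight_ge_1 c by blast
  have "(real k / 2)\<^sup>2 \<le> (c - 1 / 2)\<^sup>2"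
    using Suc.IH c by (simp add: power2_eq_square algebra_simps)
  then have "real k / 2 \<le> c - 1 / 2"
    by (rule power2_le_imp_le) (use \<open>c \<ge> 1\<close> in simp)
  then have "(real (Suc k) / 2)\<^sup>2 \<le> c\<^sup>2"
    by (intro power_mono) auto
  then show ?case
    using A[of k] c by (simp add: c_def power_divide)
qed

theorem theorem8:
  fixes B :: "'a::euclidean_space \<Rightarrow> ('a \<Rightarrow>\<^sub>L real)"
    and F :: "'a \<Rightarrow> real^'m \<Rightarrow> ereal"
    and f :: "'a \<Rightarrow> real^'m"
    and df :: "'m \<Rightarrow> 'a \<Rightarrow> ('a \<Rightarrow>\<^sub>L real)"
    and L :: "real^'m"
    and \<alpha> M :: real
    and x0 xstar :: 'a
    and a A :: "nat \<Rightarrow> real"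
    and x y v :: "nat \<Rightarrow> 'a"
  assumes B: "self_adjoint_pos_def B"
    and F_not_MInf: "\<And>z u. F z u \<noteq> - \<infinity>"
    and F_closed_convex: "closed_convex_fun (\<lambda>(z, u). F z u)"
    and F_mono: "\<And>z. mono (F z)"
    and F_subhom: "subhomogeneous_on (composite_dom F f) F"
    and f_convex: "\<And>i. convex_on UNIV (\<lambda>z. f z $ i)"
    and f_deriv: "\<And>i z. ((\<lambda>w. f w $ i) has_derivative blinfun_apply (df i z)) (at z)"
    and df_cont: "\<And>i. continuous_on UNIV (df i)"
    and df_Lipschitz: "\<And>i z w. dual_normB B (df i z - df i w) \<le> L $ i * normB B (z - w)"
    and FL_finite: "outer_sup (composite_dom F f) F L < \<infinity>"
    and xstar: "is_arg_min (composite F f) (\<lambda>z. z \<in> composite_dom F f) xstar"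
    and x0: "x0 \<in> composite_dom F f"
    and alpha: "\<alpha> \<ge> 1"
    and M: "ereal M = ereal \<alpha> * outer_sup (composite_dom F f) F L"
    and init: "x 0 = x0" "v 0 = x0" "A 0 = 0"
    and a_step: "\<And>k. a (Suc k) > 0 \<and> A k + a (Suc k) = (a (Suc k))\<^sup>2"
    and A_step: "\<And>k. A (Suc k) = A k + a (Suc k)"
    and y_step: "\<And>k. y k = (1 / A (Suc k)) *\<^sub>R (a (Suc k) *\<^sub>R v k + A k *\<^sub>R x k)"
    and x_step: "\<And>k. is_arg_min
          (\<lambda>z. F z (linearization f df (y k) z) + ereal (M / 2 * (normB B (z - y k))\<^sup>2))
          (\<lambda>z. z \<in> composite_dom F f) (x (Suc k))"
    and v_step: "\<And>k. v (Suc k) = x (Suc k) + (A k / a (Suc k)) *\<^sub>R (x (Suc k) - x k)"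
  shows "(\<forall>k\<ge>1. \<forall>z\<in>composite_dom F f.
            ereal (A k) * composite F f (x k) + ereal (M / 2 * (normB B (z - v k))\<^sup>2)
              \<le> ereal (A k) * composite F f z + ereal (M / 2 * (normB B (z - x0))\<^sup>2)) \<and>
         (\<forall>k\<ge>1.
            composite F f (x k) - composite_opt F f
              \<le> ereal (M * (normB B (xstar - x0))\<^sup>2 / (2 * A k)) \<and>
            M * (normB B (xstar - x0))\<^sup>2 / (2 * A k)
              \<le> 2 * M * (normB B (xstar - x0))\<^sup>2 / (real k)\<^sup>2)"
proof -
  let ?D = "composite_dom F f"
  define \<phi> where "\<phi> z = real_of_ereal (composite F f z)" for z
  have \<phi>: "composite F f z = ereal (\<phi> z)" if "z \<in> ?D" for z
    unfolding \<phi>_def composite_def using subhomogeneous_on_real[OF F_subhom that] .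
  have D: "convex ?D"
    by (rule convex_composite_dom[OF F_closed_convex F_mono F_subhom f_convex])
  have \<phi>_convex: "convex_on ?D \<phi>"
    unfolding \<phi>_def composite_def
    by (rule convex_on_monotone_composition[OF F_closed_convex F_mono F_subhom D f_convex])

  \<comment> \<open>Lipschitz constants are nonnegative only because the space contains a nonzero vector.\<close>
  have L_nonneg: "0 \<le> L"
    unfolding less_eq_vec_def
  proof
    fix i
    obtain b :: 'a where "b \<in> Basis"
      using nonempty_Basis by blast
    then have pos: "normB B (b - 0) > 0"
      using normB_pos[OF B, of b] nonzero_Basis by auto
    have "0 \<le> L $ i * normB B (b - 0)"
      by (rule order_trans[OF dual_normB_nonneg[OF B] df_Lipschitz])
    then show "(0 :: real^'m) $ i \<le> L $ i"
      using pos by (simp add: zero_le_mult_iff)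
  qed
  have sup_nonneg: "0 \<le> outer_sup ?D F L"
    unfolding outer_sup_def using x0
    by (rule SUP_upper2) (rule subhomogeneous_on_nonneg[where F = F, OF F_subhom F_mono x0 L_nonneg])
  have FL: "outer_sup ?D F L \<le> ereal M"
    unfolding M using ereal_mult_right_mono[OF _ sup_nonneg, of 1 "ereal \<alpha>"] alpha by simp
  have F_le_M: "F z L \<le> ereal M" if "z \<in> ?D" for z
    by (rule order_trans[OF _ FL]) (unfold outer_sup_def, rule SUP_upper[OF that])
  have M_nonneg: "0 \<le> M"
    using order_trans[OF sup_nonneg FL] by simp

  have xD: "x k \<in> ?D" for k
    using x0 init x_step by (cases k) (auto simp: is_arg_min_def)
  have A_bound: "(real k)\<^sup>2 / 4 \<le> A k" for k
    using accelerated_weights_growth[OF init(3) a_step A_step] .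
  have A_nonneg: "0 \<le> A k" for k
    by (rule order_trans[OF _ A_bound]) simp

  have potential: "A k * \<phi> (x k) + M / 2 * (normB B (z - v k))\<^sup>2 \<le>
      A k * \<phi> z + M / 2 * (normB B (z - x0))\<^sup>2" if z: "z \<in> ?D" for k z
  proof (induction k)
    case 0
    then show ?case by (simp add: init)
  next
    case (Suc k)
    have Ac: "A (Suc k) = (a (Suc k))\<^sup>2"
      using a_step[of k] A_step[of k] by simp
    have "(a (Suc k))\<^sup>2 * \<phi> (x (Suc k)) + M / 2 * (normB B (z - v (Suc k)))\<^sup>2 \<le>
        A k * \<phi> (x k) + a (Suc k) * \<phi> z + M / 2 * (normB B (z - v k))\<^sup>2"
    proof (rule accelerated_potential_step[OF B \<phi>_convex _ _ A_nonneg _ _ v_step xD z])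
      show "\<phi> (x (Suc k)) + M / 2 * (normB B (w - x (Suc k)))\<^sup>2 \<le>
          \<phi> w + M / 2 * (normB B (w - y k))\<^sup>2" if "w \<in> ?D" for w
        unfolding \<phi>_def
        by (rule composite_prox_step[OF B F_closed_convex F_mono F_subhom D f_convex f_deriv
              df_Lipschitz F_le_M x_step that])
      show "y k = (1 / (a (Suc k))\<^sup>2) *\<^sub>R (a (Suc k) *\<^sub>R v k + A k *\<^sub>R x k)"
        using y_step[of k] Ac by simp
    qed (use a_step[of k] in auto)
    then show ?case
      using Suc.IH A_step[of k] by (simp add: Ac[symmetric] distrib_right)
  qed

  have xstarD: "xstar \<in> ?D"
    using xstar by (simp add: is_arg_min_def)
  have opt: "composite_opt F f = ereal (\<phi> xstar)"
    unfolding composite_opt_def \<phi>[OF xstarD, symmetric]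
  proof (rule antisym)
    show "(INF z\<in>?D. composite F f z) \<le> composite F f xstar"
      by (rule INF_lower[OF xstarD])
    show "composite F f xstar \<le> (INF z\<in>?D. composite F f z)"
      using xstar by (intro INF_greatest) (simp add: is_arg_min_linorder)
  qed

  have "ereal (A k) * composite F f (x k) + ereal (M / 2 * (normB B (z - v k))\<^sup>2)
      \<le> ereal (A k) * composite F f z + ereal (M / 2 * (normB B (z - x0))\<^sup>2)"
    if "z \<in> ?D" for k z
    using potential[OF that, of k] by (simp add: \<phi>[OF that] \<phi>[OF xD])
  moreover have "composite F f (x k) - composite_opt F f
      \<le> ereal (M * (normB B (xstar - x0))\<^sup>2 / (2 * A k)) \<and>
    M * (normB B (xstar - x0))\<^sup>2 / (2 * A k) \<le> 2 * M * (normB B (xstar - x0))\<^sup>2 / (real k)\<^sup>2"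
    if k: "k \<ge> 1" for k
  proof
    have k2: "(real k)\<^sup>2 > 0"
      using k by simp
    then have A_pos: "A k > 0"
      using A_bound[of k] by linarith
    have "0 \<le> M / 2 * (normB B (xstar - v k))\<^sup>2"
      using M_nonneg by simp
    then have "A k * (\<phi> (x k) - \<phi> xstar) \<le> M * (normB B (xstar - x0))\<^sup>2 / 2"
      using potential[OF xstarD, of k] by (simp add: right_diff_distrib)
    then have "\<phi> (x k) - \<phi> xstar \<le> M * (normB B (xstar - x0))\<^sup>2 / (2 * A k)"
      using A_pos by (simp add: field_simps)
    then show "composite F f (x k) - composite_opt F f \<le>
        ereal (M * (normB B (xstar - x0))\<^sup>2 / (2 * A k))"
      by (simp add: opt \<phi>[OF xD])
    have "M * (normB B (xstar - x0))\<^sup>2 / (2 * A k) \<le>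
        M * (normB B (xstar - x0))\<^sup>2 / ((real k)\<^sup>2 / 2)"
      using A_bound[of k] k2 A_pos M_nonneg by (intro divide_left_mono) auto
    then show "M * (normB B (xstar - x0))\<^sup>2 / (2 * A k) \<le>
        2 * M * (normB B (xstar - x0))\<^sup>2 / (real k)\<^sup>2"
      by (simp add: mult_ac)
  qed
  ultimately show ?thesis
    by blast
qed

end
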